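(* Let $K\subset\mathbf{E}^d$ be closed and let $R>0$. Then $\mathrm{reach}(K)\ge R$ if and only if for every $b_1,b_2\in K$ with $\|b_1-b_2\|<2R$, the set $K\cap \mathfrak{H}(b_1,b_2,R)$ is connected.
   Context: $\mathbf{E}^d$ is $d$-dimensional Euclidean space, with norm $\|\cdot\|$. $B(x,r)$ and $D(x,r)$ denote the open and closed balls with center $x$ and radius $r>0$. For $A\subset\mathbf{E}^d$, $\delta_A(a)=\inf\{\|a-x\|: x\in A\}$ is the distance from $a$ to $A$. For a closed set $K\subset\mathbf{E}^d$, $\mathrm{Unp}(K)$ is the set of points $a\in\mathbf{E}^d$ for which there is a unique $x\in K$ with $\delta_K(a)=\|a-x\|$. For $a\in K$, $\mathrm{reach}(K,a)=\sup\{r>0: B(a,r)\subset\mathrm{Unp}(K)\}$ (with value $0$ if there is no such $r$), and $\mathrm{reach}(K)=\inf_{a\in K}\mathrm{reach}(K,a)\in[0,\infty]$, with the convention $\inf\emptyset=+\infty$. For $R>0$ and $a,b\in\mathbf{E}^d$ with $\|a-b\|\le 2R$, $\mathfrak{H}(a,b,R)$ is the intersection of all closed balls of radius $R$ containing both $a$ and $b$, i.e. $\mathfrak{H}(a,b,R)=\bigcap\{D(x,R): \|a-x\|\le R,\ \|b-x\|\le R\}$ (in particular $\mathfrak{H}(a,a,R)=\{a\}$). *)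

theory Defs
  imports "HOL-Analysis.Analysis"
begin

text \<open>
  The value of \<^const>\<open>infdist\<close> at an empty set is irrelevant here, since \<open>x \<in> K\<close> is required.
\<close>

definition Unp :: "'a::euclidean_space set \<Rightarrow> 'a set" where
  "Unp K = {a. \<exists>!x. x \<in> K \<and> infdist a K = norm (a - x)}"

text \<open>
  The reach takes values in \<open>[0, \<infinity>]\<close>. In \<^typ>\<open>ennreal\<close> the supremum of the empty set is \<open>0\<close> and
  its infimum is \<open>\<infinity>\<close>, which are exactly the intended conventions for a point around which no
  ball lies in \<open>Unp K\<close> and for \<open>K = {}\<close>.
\<close>

definition reach_at :: "'a::euclidean_space set \<Rightarrow> 'a \<Rightarrow> ennreal" where
  "reach_at K a = (SUP r\<in>{r::real. 0 < r \<and> ball a r \<subseteq> Unp K}. ennreal r)"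

definition reach :: "'a::euclidean_space set \<Rightarrow> ennreal" where
  "reach K = (INF a\<in>K. reach_at K a)"

text \<open>
  Meaningful for \<open>R > 0\<close> and \<open>norm (a - b) \<le> 2 * R\<close>; if \<open>norm (a - b) > 2 * R\<close>, the family of
  balls is empty and the intersection is the whole space.
\<close>

definition ball_hull :: "'a::euclidean_space \<Rightarrow> 'a \<Rightarrow> real \<Rightarrow> 'a set" where
  "ball_hull a b R = \<Inter>{cball x R |x. norm (a - x) \<le> R \<and> norm (b - x) \<le> R}"

end

theory Submission
  imports Defs
begin

text \<open>
  If a point at distance \<open>r < R\<close> from \<open>K\<close> has two nearest points \<open>b1\<close>, \<open>b2\<close>, then the
  hull of \<open>b1\<close>, \<open>b2\<close> meets the sphere of radius \<open>r\<close> around it only in \<open>b1\<close>, \<open>b2\<close>, so it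
  meets \<open>K\<close> in a two-point set.

  Conversely, let \<open>reach K \<ge> R\<close>. The nearest-point map \<open>p\<close> is continuous where the distance
  to \<open>K\<close> is less than \<open>R\<close>. By Brouwer's theorem, whenever \<open>u\<close> is the unit direction from
  \<open>p x\<close> to \<open>x\<close>, the open ball of radius \<open>R\<close> around \<open>p x + R u\<close> misses \<open>K\<close>.
  Hence \<open>p\<close> maps the segment from \<open>z1\<close> to \<open>z2\<close> into the hull of \<open>z1\<close>, \<open>z2\<close>: comparing
  powers with respect to two balls of equal radius gives an affine function, whose sign is
  controlled at \<open>z1\<close> and \<open>z2\<close>.
\<close>

section \<open>Hulls of two points\<close>

lemma mem_ball_hull_iff:
  "y \<in> ball_hull a b R \<longleftrightarrow> (\<forall>c. norm (a - c) \<le> R \<longrightarrow> norm (b - c) \<le> R \<longrightarrow> norm (y - c) \<le> R)"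
  by (auto simp: ball_hull_def dist_norm norm_minus_commute)

lemma ball_hull_mono:
  assumes "z1 \<in> ball_hull a b R" "z2 \<in> ball_hull a b R"
  shows "ball_hull z1 z2 R \<subseteq> ball_hull a b R"
  using assms unfolding subset_iff mem_ball_hull_iff by blast

text \<open>Moving the centre from \<open>x\<close> directly away from \<open>y\<close> by
  \<open>R - r\<close> gives a ball of radius \<open>R\<close> that contains
  \<open>cball x r\<close>, hence \<open>a\<close> and \<open>b\<close>, and whose centre has
  distance \<open>norm (y - x) + (R - r)\<close> from \<open>y\<close>.\<close>

lemma ball_hull_subset_cball:
  assumes "norm (a - x) \<le> r" "norm (b - x) \<le> r" "r \<le> R"
  shows "ball_hull a b R \<subseteq> cball x r"
proof
  fix y assume y: "y \<in> ball_hull a b R"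
  show "y \<in> cball x r"
  proof (cases "y = x")
    case True
    then show ?thesis using order_trans[OF norm_ge_zero assms(1)] by simp
  next
    case False
    define v where "v = (y - x) /\<^sub>R norm (y - x)"
    define c where "c = x - (R - r) *\<^sub>R v"
    have nv: "norm v = 1" using False by (simp add: v_def)
    have nc: "norm (x - c) = R - r" using nv assms(3) by (simp add: c_def)
    have "norm (a - c) \<le> R" "norm (b - c) \<le> R"
      using norm_triangle_ineq[of "a - x" "x - c"] norm_triangle_ineq[of "b - x" "x - c"] nc assms
      by auto
    then have "norm (y - c) \<le> R" using y by (simp add: mem_ball_hull_iff)
    moreover have "y - c = (norm (y - x) + (R - r)) *\<^sub>R v"
      using False by (simp add: c_def v_def algebra_simps)
    then have "norm (y - c) = norm (y - x) + (R - r)"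
      using nv assms(3) by simp
    ultimately show ?thesis by (simp add: dist_norm norm_minus_commute)
  qed
qed

text \<open>Strict convexity: equality in the triangle inequality makes the vectors point the same
  way, and equal norms then make them equal.\<close>

lemma norm_add_sub_less:
  fixes w u :: "'a::real_inner"
  assumes "norm w = norm u" "w \<noteq> u" "s > 0"
  shows "norm (w + s *\<^sub>R u) < norm u + s * norm u"
proof -
  have "norm (w + s *\<^sub>R u) \<noteq> norm w + norm (s *\<^sub>R u)"
  proof
    assume "norm (w + s *\<^sub>R u) = norm w + norm (s *\<^sub>R u)"
    then have "norm w *\<^sub>R s *\<^sub>R u = norm (s *\<^sub>R u) *\<^sub>R w"
      by (simp only: norm_triangle_eq)
    then have "(norm u * s) *\<^sub>R (u - w) = 0"
      using assms by (simp add: algebra_simps)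
    then show False using assms by auto
  qed
  then show ?thesis
    using norm_triangle_ineq[of w "s *\<^sub>R u"] assms by simp
qed

text \<open>The ball of radius \<open>R\<close> internally tangent to the sphere at \<open>y\<close>
  has every other point of the sphere in its interior. Shifting it slightly away from
  \<open>y\<close> keeps \<open>a\<close> and \<open>b\<close> but loses \<open>y\<close>.\<close>

lemma ball_hull_Int_sphere:
  assumes a: "norm (a - x) = r" and b: "norm (b - x) = r" and r: "0 < r" "r < R"
    and y: "y \<in> ball_hull a b R" and yx: "norm (y - x) = r"
  shows "y = a \<or> y = b"
proof (rule ccontr)
  assume ne: "\<not> (y = a \<or> y = b)"
  define s where "s = (R - r) / r"
  have s: "s > 0" "r + s * r = R" using r by (auto simp: s_def)
  define c where "c = x - s *\<^sub>R (y - x)"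
  have lt: "norm (z - c) < R" if "norm (z - x) = r" "z \<noteq> y" for z
    using norm_add_sub_less[of "z - x" "y - x" s] that yx s
    by (simp add: c_def algebra_simps)
  have "norm (a - c) < R" "norm (b - c) < R" using lt a b ne by auto
  then obtain e where e: "e > 0" "norm (a - c) + e \<le> R" "norm (b - c) + e \<le> R"
    using that[of "min (R - norm (a - c)) (R - norm (b - c))"] by auto
  define c' where "c' = c - (e / r) *\<^sub>R (y - x)"
  have nc: "norm (c - c') = e" using e r yx by (simp add: c'_def)
  have "norm (a - c') \<le> R" "norm (b - c') \<le> R"
    using norm_triangle_ineq[of "a - c" "c - c'"] norm_triangle_ineq[of "b - c" "c - c'"] nc e
    by auto
  then have "norm (y - c') \<le> R" using y by (simp add: mem_ball_hull_iff)
  moreover have "y - c' = (1 + s + e / r) *\<^sub>R (y - x)"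
    by (simp add: c'_def c_def algebra_simps)
  then have "norm (y - c') = (1 + s + e / r) * r"
    using yx s e r by simp
  then have "norm (y - c') = R + e"
    using s r by (simp add: algebra_simps)
  ultimately show False using e by simp
qed

section \<open>The nearest-point map\<close>

lemma closest_point_infdist:
  fixes K :: "'a::euclidean_space set"
  assumes "closed K" "K \<noteq> {}"
  shows "closest_point K x \<in> K" "norm (x - closest_point K x) = infdist x K"
proof -
  show *: "closest_point K x \<in> K" by (rule closest_point_in_set[OF assms])
  obtain q where "q \<in> K" "infdist x K = dist x q"
    using infdist_attains_inf[OF assms] by blast
  then show "norm (x - closest_point K x) = infdist x K"
    using closest_point_le[OF assms(1), of q x] infdist_le[OF *, of x]
    by (simp add: dist_norm)
qed

lemma closest_point_unique_Unp:
  assumes "closed K" "x \<in> Unp K" "q \<in> K" "norm (x - q) = infdist x K"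
  shows "closest_point K x = q"
proof -
  have "K \<noteq> {}" using assms(3) by auto
  then have "closest_point K x \<in> K \<and> infdist x K = norm (x - closest_point K x)"
    using closest_point_infdist[OF assms(1)] by simp
  moreover have "\<exists>!q. q \<in> K \<and> infdist x K = norm (x - q)"
    using assms(2) by (simp add: Unp_def)
  ultimately show ?thesis using assms(3,4) by auto
qed

text \<open>By uniqueness, the part of \<open>K\<close> outside \<open>ball (?p x) e\<close> is
  strictly farther from \<open>x\<close> than \<open>K\<close> is. Moving \<open>x\<close> by less
  than half this gap cannot bring the nearest point there.\<close>

lemma continuous_on_closest_point_Unp:
  fixes K :: "'a::euclidean_space set"
  assumes K: "closed K" "K \<noteq> {}" and "U \<subseteq> Unp K"
  shows "continuous_on U (closest_point K)"
  unfolding continuous_on_iff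
proof (intro ballI allI impI)
  fix x and e :: real assume x: "x \<in> U" and e: "e > 0"
  let ?p = "closest_point K"
  define C where "C = K - ball (?p x) e"
  have C: "closed C" using K by (simp add: C_def closed_Diff)
  show "\<exists>d>0. \<forall>x'\<in>U. dist x' x < d \<longrightarrow> dist (?p x') (?p x) < e"
  proof (cases "C = {}")
    case True
    then have "dist (?p x') (?p x) < e" for x'
      using closest_point_infdist(1)[OF K, of x'] by (auto simp: C_def dist_commute)
    then show ?thesis using e by (auto intro!: exI[of _ 1])
  next
    case False
    obtain q where q: "q \<in> C" "infdist x C = dist x q"
      using infdist_attains_inf[OF C False] by blast
    have "infdist x K \<le> norm (x - q)"
      using q infdist_le[of q K x] by (auto simp: C_def dist_norm)
    moreover have "infdist x K \<noteq> norm (x - q)"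
      using closest_point_unique_Unp[OF K(1), of x q] q x e assms(3) by (auto simp: C_def)
    ultimately have lt: "infdist x K < infdist x C" using q by (simp add: dist_norm)
    define d where "d = (infdist x C - infdist x K) / 2"
    have "dist (?p x') (?p x) < e" if "dist x' x < d" for x'
    proof (rule ccontr)
      assume "\<not> dist (?p x') (?p x) < e"
      then have "?p x' \<in> C"
        using closest_point_infdist(1)[OF K] by (auto simp: C_def dist_commute)
      then have "infdist x C \<le> dist x (?p x')" by (rule infdist_le)
      also have "\<dots> \<le> dist x x' + infdist x' K"
        using dist_triangle[of x "?p x'" x'] closest_point_infdist(2)[OF K, of x']
        by (simp add: dist_norm)
      also have "\<dots> \<le> 2 * dist x x' + infdist x K"
        using infdist_triangle[of x' K x] by (simp add: dist_commute)
      finally show False using that by (simp add: d_def dist_commute)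
    qed
    then show ?thesis using lt by (auto intro!: exI[of _ d] simp: d_def)
  qed
qed

text \<open>
  The fixed point \<open>y\<close> below satisfies \<open>y = x + e (x - p y) / |x - p y|\<close>. Thus \<open>x\<close> lies between
  \<open>p y\<close> and \<open>y\<close>, which forces \<open>p x = p y\<close>.
\<close>

lemma infdist_extend_normal:
  fixes K :: "'a::euclidean_space set"
  assumes K: "closed K" "K \<noteq> {}" and e: "e > 0" and U: "cball x e \<subseteq> Unp K"
    and x: "x \<notin> K" and p: "p \<in> K" "norm (x - p) = infdist x K"
  shows "infdist (x + (e / norm (x - p)) *\<^sub>R (x - p)) K = norm (x - p) + e"
proof -
  let ?p = "closest_point K"
  define F where "F = (\<lambda>y. x + (e / norm (x - ?p y)) *\<^sub>R (x - ?p y))"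
  have ne: "norm (x - ?p y) \<noteq> 0" for y
    using closest_point_infdist(1)[OF K, of y] x by auto
  have "continuous_on (cball x e) F"
    unfolding F_def
    by (intro continuous_intros continuous_on_closest_point_Unp K U) (use ne in auto)
  moreover have "F \<in> cball x e \<rightarrow> cball x e"
    using ne e by (auto simp: F_def dist_norm)
  ultimately obtain y where y: "y \<in> cball x e" "F y = y"
    using brouwer[of "cball x e" F] e by (auto simp: Pi_iff)
  define t where "t = e / norm (x - ?p y)"
  have nt: "t * norm (x - ?p y) = e" "t > 0" using e ne[of y] by (auto simp: t_def)
  have yt: "y - x = t *\<^sub>R (x - ?p y)" using y(2) by (simp add: F_def t_def algebra_simps)
  have ny: "norm (y - x) = e" using yt nt by simp
  have "y - ?p y = (t + 1) *\<^sub>R (x - ?p y)" using yt by (simp add: algebra_simps)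
  then have "norm (y - ?p y) = (t + 1) * norm (x - ?p y)"
    using nt(2) by simp
  then have npy: "infdist y K = norm (x - ?p y) + e"
    using nt(1) closest_point_infdist(2)[OF K, of y] by (simp add: distrib_right)
  \<comment> \<open>The distance to \<open>K\<close> is 1-Lipschitz, so \<open>?p y\<close> is also
    nearest to \<open>x\<close>.\<close>
  have "infdist y K \<le> infdist x K + e"
    using infdist_triangle[of y K x] ny by (simp add: dist_norm)
  then have "norm (x - ?p y) = infdist x K"
    using npy infdist_le[OF closest_point_infdist(1)[OF K, of y], of x] by (simp add: dist_norm)
  moreover have "x \<in> Unp K" using U e by auto
  ultimately have "?p y = p"
    using closest_point_unique_Unp[OF K(1)] closest_point_infdist(1)[OF K] p by metis
  then show ?thesis using npy y(2) by (simp add: F_def)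
qed

text \<open>Continuation: the parameters at which \<open>p\<close> is still nearest form a compact
  set, and \<open>infdist_extend_normal\<close> passes beyond any maximum below
  \<open>R\<close>.\<close>

lemma infdist_normal_ray:
  fixes K :: "'a::euclidean_space set"
  assumes K: "closed K" "K \<noteq> {}" and U: "\<And>x. infdist x K < R \<Longrightarrow> x \<in> Unp K"
    and u: "norm u = 1" and p: "p \<in> K" and t0: "0 < t0" "t0 < R" "infdist (p + t0 *\<^sub>R u) K = t0"
  shows "infdist (p + R *\<^sub>R u) K = R"
proof -
  define S where "S = {t \<in> {0..R}. infdist (p + t *\<^sub>R u) K = t}"
  have "S = {0..R} \<inter> {t. infdist (p + t *\<^sub>R u) K = t}" by (auto simp: S_def)
  moreover have "closed {t. infdist (p + t *\<^sub>R u) K = t}"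
    by (intro closed_Collect_eq continuous_intros)
  ultimately have "compact S" by (simp add: compact_Int_closed)
  moreover have "t0 \<in> S" using t0 by (auto simp: S_def)
  ultimately obtain T where T: "T \<in> S" "\<And>t. t \<in> S \<Longrightarrow> t \<le> T"
    using compact_attains_sup[of S] by auto
  have T0: "0 < T" using T(2)[OF \<open>t0 \<in> S\<close>] t0 by simp
  show ?thesis
  proof (cases "T = R")
    case True
    then show ?thesis using T(1) by (simp add: S_def)
  next
    case False
    define x where "x = p + T *\<^sub>R u"
    have x: "infdist x K = T" "T < R" using T(1) False by (auto simp: S_def x_def)
    \<comment> \<open>Half the remaining length keeps \<open>cball x e\<close> where the distance to
      \<open>K\<close> is below \<open>R\<close>.\<close>
    define e where "e = (R - T) / 2"
    have e: "e > 0" "T + e < R" using x by (auto simp: e_def field_simps)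
    have np: "norm (x - p) = T" using T0 u by (simp add: x_def)
    have "cball x e \<subseteq> Unp K"
    proof
      fix y assume "y \<in> cball x e"
      then show "y \<in> Unp K"
        using infdist_triangle[of y K x] x e by (intro U) (auto simp: dist_commute)
    qed
    moreover have "x \<notin> K" using x T0 by auto
    ultimately have "infdist (x + (e / T) *\<^sub>R (x - p)) K = T + e"
      using infdist_extend_normal[OF K e(1), of x p] p np x by simp
    moreover have "x + (e / T) *\<^sub>R (x - p) = p + (T + e) *\<^sub>R u"
      using T0 by (simp add: x_def algebra_simps)
    ultimately have "T + e \<in> S" using T0 e by (simp add: S_def)
    then show ?thesis using T(2) e by force
  qed
qed

section \<open>Reach and hulls\<close>

text \<open>The points at distance less than \<open>R\<close> from \<open>K\<close> are exactly
  those in the balls of radius \<open>R\<close> about points of \<open>K\<close>.\<close>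

lemma reach_ge_iff_Unp:
  fixes K :: "'a::euclidean_space set"
  assumes "closed K" "K \<noteq> {}" "R > 0"
  shows "reach K \<ge> ennreal R \<longleftrightarrow> (\<forall>x. infdist x K < R \<longrightarrow> x \<in> Unp K)"
proof (intro iffI allI impI)
  fix x assume reach: "reach K \<ge> ennreal R" and x: "infdist x K < R"
  obtain a where a: "a \<in> K" "infdist x K = dist x a"
    using infdist_attains_inf[OF assms(1,2)] by blast
  have "ennreal (dist x a) < ennreal R" using a x assms by (simp add: ennreal_less_iff)
  also have "\<dots> \<le> reach_at K a" using reach a by (auto simp: reach_def le_INF_iff)
  finally obtain r where "0 < r" "ball a r \<subseteq> Unp K" "ennreal (dist x a) < ennreal r"
    by (auto simp: reach_at_def less_SUP_iff)
  then show "x \<in> Unp K" by (auto simp: ennreal_less_iff dist_commute)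
next
  assume U: "\<forall>x. infdist x K < R \<longrightarrow> x \<in> Unp K"
  have "ball a R \<subseteq> Unp K" if "a \<in> K" for a
  proof
    fix x assume "x \<in> ball a R"
    then show "x \<in> Unp K" using U infdist_le[OF that, of x] by (auto simp: dist_commute)
  qed
  then show "reach K \<ge> ennreal R"
    using assms(3) by (auto simp: reach_def reach_at_def intro!: INF_greatest SUP_upper)
qed

lemma affine_nonpos_on_segment:
  fixes v :: "'a::real_inner"
  assumes "x \<in> closed_segment a b" "a \<bullet> v \<le> \<beta>" "b \<bullet> v \<le> \<beta>"
  shows "x \<bullet> v \<le> \<beta>"
proof -
  have "convex {y. y \<bullet> v \<le> \<beta>}"
    using convex_halfspace_le[of v \<beta>] by (simp add: inner_commute)
  then have "closed_segment a b \<subseteq> {y. y \<bullet> v \<le> \<beta>}"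
    using assms by (intro closed_segment_subset) auto
  then show ?thesis using assms by auto
qed

text \<open>
  With \<open>c' = p x + R u\<close>, the difference \<open>|y - c|^2 - |y - c'|^2\<close> is affine in \<open>y\<close>. It is
  nonpositive at \<open>a\<close> and \<open>b\<close>, hence at \<open>x\<close>; were it positive at \<open>p x\<close>, it would be negative
  further along the ray, at \<open>c'\<close>, where it equals \<open>|c' - c|^2\<close>.
\<close>

lemma closest_point_segment_in_ball_hull:
  fixes K :: "'a::euclidean_space set"
  assumes K: "closed K" and U: "\<And>x. infdist x K < R \<Longrightarrow> x \<in> Unp K"
    and a: "a \<in> K" and b: "b \<in> K" and x: "x \<in> closed_segment a b" "infdist x K < R"
  shows "closest_point K x \<in> ball_hull a b R"
  unfolding mem_ball_hull_iff
proof (intro allI impI)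
  fix c assume ac: "norm (a - c) \<le> R" and bc: "norm (b - c) \<le> R"
  have K0: "K \<noteq> {}" using a by auto
  define p where "p = closest_point K x"
  have p: "p \<in> K" "norm (x - p) = infdist x K"
    using closest_point_infdist[OF K K0] by (auto simp: p_def)
  have "norm (p - c) \<le> R"
  proof (cases "x = p")
    \<comment> \<open>There is no normal direction here, but convexity of \<open>cball c R\<close>
      suffices.\<close>
    case True
    have "closed_segment a b \<subseteq> cball c R"
      using ac bc by (intro closed_segment_subset) (auto simp: dist_norm norm_minus_commute)
    then show ?thesis using x True by (auto simp: dist_norm norm_minus_commute)
  next
    case False
    define t where "t = norm (x - p)"
    define u where "u = (x - p) /\<^sub>R t"
    have t: "0 < t" "t < R" unfolding t_def using False x(2) by (simp, simp only: p(2))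
    have u: "norm u = 1" "x = p + t *\<^sub>R u" using t by (auto simp: u_def t_def)
    define c' where "c' = p + R *\<^sub>R u"
    have "infdist c' K = R"
      unfolding c'_def
      by (rule infdist_normal_ray[OF K K0 U u(1) p(1) t]) (use u p t_def in auto)
    then have far: "R \<le> norm (y - c')" if "y \<in> K" for y
      using infdist_le[OF that, of c'] by (simp add: dist_norm norm_minus_commute)
    define v where "v = 2 *\<^sub>R (c' - c)"
    define \<beta> where "\<beta> = c' \<bullet> c' - c \<bullet> c"
    have power: "(norm (y - c))\<^sup>2 - (norm (y - c'))\<^sup>2 = y \<bullet> v - \<beta>" for y
      by (simp add: power2_norm_eq_inner v_def \<beta>_def algebra_simps inner_commute)
    have neg: "y \<bullet> v \<le> \<beta>" if "y \<in> K" "norm (y - c) \<le> R" for y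
    proof -
      have "(norm (y - c))\<^sup>2 \<le> (norm (y - c'))\<^sup>2"
        using far[OF that(1)] that(2) by (intro power_mono) auto
      then show ?thesis using power[of y] by linarith
    qed
    have xv: "p \<bullet> v + t * (u \<bullet> v) \<le> \<beta>"
      using affine_nonpos_on_segment[OF x(1) neg[OF a ac] neg[OF b bc]] u(2)
      by (simp add: inner_add_left)
    have cv: "p \<bullet> v + R * (u \<bullet> v) \<ge> \<beta>"
      using power[of c'] zero_le_power2[of "norm (c' - c)"] by (simp add: c'_def inner_add_left)
    have "(R - t) * (u \<bullet> v) \<ge> 0" using xv cv by (simp add: algebra_simps)
    then have "u \<bullet> v \<ge> 0" using t by (simp add: zero_le_mult_iff)
    then have "p \<bullet> v \<le> \<beta>" using xv t by (smt (verit) mult_nonneg_nonneg)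
    then have "(norm (p - c))\<^sup>2 \<le> (norm (p - c'))\<^sup>2" using power[of p] by linarith
    moreover have "norm (p - c') = R" using u t by (simp add: c'_def)
    ultimately show ?thesis using t by (simp add: power2_le_iff_abs_le)
  qed
  then show "norm (closest_point K x - c) \<le> R" by (simp add: p_def)
qed

lemma connected_component_ball_hull:
  fixes K :: "'a::euclidean_space set"
  assumes K: "closed K" and U: "\<And>x. infdist x K < R \<Longrightarrow> x \<in> Unp K"
    and a: "a \<in> K" and b: "b \<in> K" and ab: "norm (a - b) < 2 * R"
  shows "connected_component (K \<inter> ball_hull a b R) a b"
proof -
  let ?p = "closest_point K"
  have K0: "K \<noteq> {}" using a by auto
  \<comment> \<open>One of the endpoints is at most half the length of the segment away.\<close>
  have near: "infdist x K < R" if "x \<in> closed_segment a b" for x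
    using infdist_le[OF a, of x] infdist_le[OF b, of x] that ab
      between[of a b x] by (simp add: between_mem_segment dist_norm norm_minus_commute)
  have "connected (?p ` closed_segment a b)"
    using near U by (intro connected_continuous_image continuous_on_closest_point_Unp K K0) auto
  moreover have "?p ` closed_segment a b \<subseteq> K \<inter> ball_hull a b R"
    using closest_point_infdist(1)[OF K K0] closest_point_segment_in_ball_hull[OF K U a b] near
    by auto
  moreover have "a \<in> ?p ` closed_segment a b" "b \<in> ?p ` closed_segment a b"
    using closest_point_self[OF a] closest_point_self[OF b]
    by (metis ends_in_segment image_eqI)+
  ultimately show ?thesis unfolding connected_component_def by blast
qed

theorem theorem3p8:
  fixes K :: "'a::euclidean_space set" and R :: real
  assumes "closed K" and "R > 0"
  shows "reach K \<ge> ennreal R \<longleftrightarrow>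
    (\<forall>b1\<in>K. \<forall>b2\<in>K. norm (b1 - b2) < 2 * R \<longrightarrow> connected (K \<inter> ball_hull b1 b2 R))"
proof (cases "K = {}")
  case True
  \<comment> \<open>\<open>infdist\<close> to the empty set is 0 by default, so this case is
    separate: the infimum is infinite and the right side vacuous.\<close>
  then show ?thesis by (simp add: reach_def)
next
  case False
  have "(\<forall>x. infdist x K < R \<longrightarrow> x \<in> Unp K) \<longleftrightarrow>
    (\<forall>b1\<in>K. \<forall>b2\<in>K. norm (b1 - b2) < 2 * R \<longrightarrow> connected (K \<inter> ball_hull b1 b2 R))"
  proof (intro iffI ballI allI impI)
    fix b1 b2 :: 'a
    assume U: "\<forall>x. infdist x K < R \<longrightarrow> x \<in> Unp K" and b: "norm (b1 - b2) < 2 * R"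
    have "connected_component (K \<inter> ball_hull b1 b2 R) z1 z2"
      if z: "z1 \<in> K \<inter> ball_hull b1 b2 R" "z2 \<in> K \<inter> ball_hull b1 b2 R" for z1 z2
    proof -
      \<comment> \<open>The hull lies in the ball with diameter from \<open>b1\<close> to
        \<open>b2\<close>, so \<open>z1\<close> and \<open>z2\<close> are again less than
        \<open>2 * R\<close> apart and can be joined inside their own, smaller hull.\<close>
      define m where "m = midpoint b1 b2"
      have "ball_hull b1 b2 R \<subseteq> cball m (norm (b1 - b2) / 2)"
        using b dist_midpoint[of b1 b2]
        by (intro ball_hull_subset_cball) (auto simp: m_def dist_norm norm_minus_commute)
      then have "dist m z1 \<le> norm (b1 - b2) / 2" "dist m z2 \<le> norm (b1 - b2) / 2"
        using z by auto
      then have "norm (z1 - z2) < 2 * R"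
        using dist_triangle3[of z1 z2 m] b by (simp add: dist_norm)
      then have "connected_component (K \<inter> ball_hull z1 z2 R) z1 z2"
        using connected_component_ball_hull[OF assms(1)] U z by blast
      moreover have "K \<inter> ball_hull z1 z2 R \<subseteq> K \<inter> ball_hull b1 b2 R"
        using z ball_hull_mono[of z1 b1 b2 R z2] by auto
      ultimately show ?thesis using connected_component_of_subset by blast
    qed
    then show "connected (K \<inter> ball_hull b1 b2 R)"
      by (simp add: connected_iff_connected_component)
  next
    fix x :: 'a
    assume conn: "\<forall>b1\<in>K. \<forall>b2\<in>K. norm (b1 - b2) < 2 * R \<longrightarrow> connected (K \<inter> ball_hull b1 b2 R)"
      and x: "infdist x K < R"
    define r where "r = infdist x K"
    have eq: "b1 = b2"
      if b1: "b1 \<in> K" "r = norm (x - b1)" and b2: "b2 \<in> K" "r = norm (x - b2)" for b1 b2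
    proof (rule ccontr)
      assume ne: "b1 \<noteq> b2"
      have n: "norm (b1 - x) = r" "norm (b2 - x) = r" using b1 b2 by (auto simp: norm_minus_commute)
      have r: "0 < r" "r < R" using ne b1 b2 x by (auto simp: r_def)
      have "norm (b1 - b2) < 2 * R"
        using norm_triangle_ineq4[of "b1 - x" "b2 - x"] n r by simp
      then have "connected (K \<inter> ball_hull b1 b2 R)" using conn b1 b2 by blast
      \<comment> \<open>The hull lies in the closed ball of radius \<open>r\<close> about
        \<open>x\<close>, and \<open>K\<close> misses the open one, so only the sphere
        remains.\<close>
      moreover have "K \<inter> ball_hull b1 b2 R = {b1, b2}"
      proof (intro equalityI subsetI)
        fix y assume y: "y \<in> K \<inter> ball_hull b1 b2 R"
        have "norm (y - x) \<le> r"
          using ball_hull_subset_cball[of b1 x r b2 R] n r y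
          by (auto simp: dist_norm norm_minus_commute)
        moreover have "r \<le> norm (y - x)"
          using infdist_le[of y K x] y by (simp add: r_def dist_norm norm_minus_commute)
        ultimately show "y \<in> {b1, b2}"
          using ball_hull_Int_sphere[OF n r, of y] y by auto
      qed (use b1 b2 in \<open>auto simp: mem_ball_hull_iff\<close>)
      ultimately show False
        using ne connected_finite_iff_sing[of "{b1, b2}"] by auto
    qed
    have "\<exists>!b. b \<in> K \<and> r = norm (x - b)"
      using closest_point_infdist[OF assms(1) False, of x] eq
      by (intro ex1I[of _ "closest_point K x"]) (auto simp: r_def)
    then show "x \<in> Unp K" by (simp add: Unp_def r_def)
  qed
  then show ?thesis using reach_ge_iff_Unp[OF assms(1) False assms(2)] by simp
qed

end
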